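(* Let $X$ be a Priestley space, let $Y$ be an Esakia root system and let $f\colon Y\to X$ be an order-preserving continuous map. Then there is a unique continuous p-morphism $g\colon Y\to\mathsf{CC}(X)$ such that $m\circ g=f$, where $m\colon\mathsf{CC}(X)\to X$ sends each $C\in\mathsf{CC}(X)$ to its least element.
   Context: A Priestley space is a compact space with a partial order such that $x\not\le y$ implies a clopen upset containing $x$ but not $y$. $\mathsf{CC}(X)$ is the set of nonempty closed chains of $X$ with topology generated by $\Box V=\{C\mid C\subseteq V\}$, $\Diamond V=\{C\mid C\cap V\neq\varnothing\}$ ($V$ clopen in $X$) and order $C_1\unlhd C_2$ iff $C_2\subseteq C_1$ and $C_2$ is an upset of $C_1$; every $C\in\mathsf{CC}(X)$ has a least element. An Esakia root system is a Priestley space in which ${\downarrow}V$ is clopen for each clopen $V$ and ${\uparrow}y$ is a chain for every $y$. A p-morphism is a map $g$ between posets with $g[{\uparrow}y]={\uparrow}g(y)$ for all $y$. *)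

theory Defs
  imports "HOL-Analysis.Analysis"
begin

text \<open>
  A poset is a carrier set \<open>A\<close> with a relation \<open>r\<close> such that \<open>partial_order_on A r\<close>, where
  \<open>(x, y) \<in> r\<close> is read as \<open>x \<le> y\<close>. Since \<open>r \<subseteq> A \<times> A\<close>, for \<open>y\<close> in \<open>A\<close> and \<open>V \<subseteq> A\<close> the image
  \<open>r `` {y}\<close> is the principal upset of \<open>y\<close> and \<open>r\<inverse> `` V\<close> is the downset generated by \<open>V\<close>.
  An ordered topological space is a pair of a topology \<open>X\<close> and a relation on \<open>topspace X\<close>.
\<close>

definition clopenin :: "'a topology \<Rightarrow> 'a set \<Rightarrow> bool" where
  "clopenin X V \<longleftrightarrow> closedin X V \<and> openin X V"

definition upset_of :: "'a rel \<Rightarrow> 'a set \<Rightarrow> 'a set \<Rightarrow> bool" where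
  "upset_of r A U \<longleftrightarrow> U \<subseteq> A \<and> (\<forall>x\<in>U. \<forall>y\<in>A. (x, y) \<in> r \<longrightarrow> y \<in> U)"

definition priestley_space :: "'a topology \<Rightarrow> 'a rel \<Rightarrow> bool" where
  "priestley_space X r \<longleftrightarrow>
     compact_space X \<and> partial_order_on (topspace X) r \<and>
     (\<forall>x\<in>topspace X. \<forall>y\<in>topspace X. (x, y) \<notin> r \<longrightarrow>
        (\<exists>U. clopenin X U \<and> upset_of r (topspace X) U \<and> x \<in> U \<and> y \<notin> U))"

definition esakia_root_system :: "'a topology \<Rightarrow> 'a rel \<Rightarrow> bool" where
  "esakia_root_system Y r \<longleftrightarrow>
     priestley_space Y r \<and>
     (\<forall>V. clopenin Y V \<longrightarrow> clopenin Y (r\<inverse> `` V)) \<and>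
     (\<forall>y\<in>topspace Y. r `` {y} \<in> Chains r)"

definition p_morphism :: "'a set \<Rightarrow> 'a rel \<Rightarrow> 'b set \<Rightarrow> 'b rel \<Rightarrow> ('a \<Rightarrow> 'b) \<Rightarrow> bool" where
  "p_morphism A r B s g \<longleftrightarrow> g \<in> A \<rightarrow> B \<and> (\<forall>y\<in>A. g ` (r `` {y}) = s `` {g y})"

definition CC :: "'a topology \<Rightarrow> 'a rel \<Rightarrow> 'a set set" where
  "CC X r = {C. C \<noteq> {} \<and> closedin X C \<and> C \<in> Chains r}"

definition CC_box :: "'a topology \<Rightarrow> 'a rel \<Rightarrow> 'a set \<Rightarrow> 'a set set" where
  "CC_box X r V = {C \<in> CC X r. C \<subseteq> V}"

definition CC_diamond :: "'a topology \<Rightarrow> 'a rel \<Rightarrow> 'a set \<Rightarrow> 'a set set" where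
  "CC_diamond X r V = {C \<in> CC X r. C \<inter> V \<noteq> {}}"

definition CC_topology :: "'a topology \<Rightarrow> 'a rel \<Rightarrow> 'a set topology" where
  "CC_topology X r =
     topology_generated_by ({CC_box X r V |V. clopenin X V} \<union> {CC_diamond X r V |V. clopenin X V})"

definition CC_order :: "'a topology \<Rightarrow> 'a rel \<Rightarrow> 'a set rel" where
  "CC_order X r = {(C1, C2). C1 \<in> CC X r \<and> C2 \<in> CC X r \<and> C2 \<subseteq> C1 \<and> upset_of r C1 C2}"

definition least_elem :: "'a rel \<Rightarrow> 'a set \<Rightarrow> 'a" where
  "least_elem r C = (THE x. x \<in> C \<and> (\<forall>y\<in>C. (x, y) \<in> r))"

lemma topspace_CC_topology [simp]: "topspace (CC_topology X r) = CC X r"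
proof
  show "topspace (CC_topology X r) \<subseteq> CC X r"
    by (auto simp: CC_topology_def CC_box_def CC_diamond_def)
  have "CC X r = CC_box X r (topspace X)"
    by (auto simp: CC_box_def CC_def dest: closedin_subset)
  moreover have "clopenin X (topspace X)"
    by (simp add: clopenin_def)
  ultimately show "CC X r \<subseteq> topspace (CC_topology X r)"
    unfolding CC_topology_def topology_generated_by_topspace by blast
qed

lemma partial_order_on_CC_order: "partial_order_on (CC X r) (CC_order X r)"
  unfolding partial_order_on_def preorder_on_def
proof (intro conjI)
  show "CC_order X r \<subseteq> CC X r \<times> CC X r"
    unfolding CC_order_def by blast
  show "refl_on (CC X r) (CC_order X r)"
    unfolding refl_on_def CC_order_def upset_of_def by blast
  show "antisym (CC_order X r)"
    unfolding antisym_def CC_order_def by blast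
  show "trans (CC_order X r)"
  proof (rule transI)
    fix A B C
    assume "(A, B) \<in> CC_order X r" and "(B, C) \<in> CC_order X r"
    then have AB: "A \<in> CC X r" "B \<subseteq> A" "upset_of r A B"
      and BC: "C \<in> CC X r" "C \<subseteq> B" "upset_of r B C"
      unfolding CC_order_def by blast+
    have "upset_of r A C"
      using AB(2,3) BC(2,3) unfolding upset_of_def by (meson subset_trans subsetD)
    then show "(A, C) \<in> CC_order X r"
      using AB(1,2) BC(1,2) unfolding CC_order_def by blast
  qed
qed

lemma CC_least_ex1:
  assumes X: "priestley_space X r" and C: "C \<in> CC X r"
  shows "\<exists>!x. x \<in> C \<and> (\<forall>y\<in>C. (x, y) \<in> r)"
proof -
  have po: "refl_on (topspace X) r" "trans r" "antisym r" "r \<subseteq> topspace X \<times> topspace X"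
    using X partial_order_onD[of "topspace X" r] by (auto simp only: priestley_space_def)
  have ne: "C \<noteq> {}" and cl: "closedin X C" and ch: "C \<in> Chains r"
    using C by (auto simp: CC_def)
  have sub: "C \<subseteq> topspace X"
    using cl by (rule closedin_subset)
  have down: "closedin X (r\<inverse> `` {c})" if c: "c \<in> topspace X" for c
    unfolding closedin_def
  proof
    show "r\<inverse> `` {c} \<subseteq> topspace X" using po by auto
    show "openin X (topspace X - r\<inverse> `` {c})"
    proof (subst openin_subopen, intro ballI)
      fix x assume x: "x \<in> topspace X - r\<inverse> `` {c}"
      then obtain U where U: "clopenin X U" "upset_of r (topspace X) U" "x \<in> U" "c \<notin> U"
        using X c unfolding priestley_space_def by auto
      then have "U \<subseteq> topspace X - r\<inverse> `` {c}"
        using c by (auto simp: upset_of_def)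
      with U show "\<exists>T. openin X T \<and> x \<in> T \<and> T \<subseteq> topspace X - r\<inverse> `` {c}"
        unfolding clopenin_def by blast
    qed
  qed
  have fin: "\<exists>x\<in>C. \<forall>y\<in>F. (x, y) \<in> r" if "finite F" "F \<subseteq> C" for F
    using that
  proof (induction F)
    case empty
    then show ?case using ne by auto
  next
    case (insert a F)
    then obtain x where x: "x \<in> C" "\<forall>y\<in>F. (x, y) \<in> r" by auto
    have "a \<in> C" using insert by auto
    have aa: "(a, a) \<in> r"
      using \<open>a \<in> C\<close> sub po(1) by (auto simp: refl_on_def)
    from ch \<open>a \<in> C\<close> x(1) have "(x, a) \<in> r \<or> (a, x) \<in> r"
      by (auto simp: Chains_def)
    then show ?case
    proof
      assume "(x, a) \<in> r"
      then show ?thesis using x by auto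
    next
      assume "(a, x) \<in> r"
      then have "\<forall>y\<in>insert a F. (a, y) \<in> r"
        using x(2) aa po(2) by (auto dest: transD)
      then show ?thesis using \<open>a \<in> C\<close> by blast
    qed
  qed
  have "compactin X C"
    using X cl by (simp add: priestley_space_def closedin_compact_space)
  moreover have "C \<inter> \<Inter>\<F> \<noteq> {}" if F: "finite \<F>" "\<F> \<subseteq> (\<lambda>c. r\<inverse> `` {c}) ` C" for \<F>
  proof -
    obtain F where "F \<subseteq> C" "finite F" "\<F> = (\<lambda>c. r\<inverse> `` {c}) ` F"
      using F by (meson finite_subset_image)
    then show ?thesis using fin[of F] by auto
  qed
  moreover have "\<forall>D\<in>(\<lambda>c. r\<inverse> `` {c}) ` C. closedin X D"
    using down sub by auto
  ultimately have "C \<inter> \<Inter>((\<lambda>c. r\<inverse> `` {c}) ` C) \<noteq> {}"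
    unfolding compactin_fip by (elim conjE allE[where x = "(\<lambda>c. r\<inverse> `` {c}) ` C"]) simp
  then obtain x where "x \<in> C" "\<forall>y\<in>C. (x, y) \<in> r" by auto
  then show ?thesis
    using po(3) by (auto simp: antisym_def)
qed

end

(*
  The map is g y = f[up y]. Continuity holds because the preimage of a diamond is the downset of a
  clopen set, and that of a box is the complement of such a downset. If C is an upset of f[up y],
  then C = f[up z] for z the least element of the closed chain {w in up y | f w in C}. Conversely,
  any such g satisfies g y = f[up y]: each c in g y is the least element of the upset
  {d in g y | c <= d} of g y, which by the p-morphism condition is g z for some z >= y.
*)
theory Submission
  imports Defs
begin

section \<open>Separation, closed principal upsets and least elements in Priestley spaces\<close>

lemma priestley_spaceD:
  assumes "priestley_space X r"
  shows "compact_space X" "refl_on (topspace X) r" "trans r" "antisym r"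
    "r \<subseteq> topspace X \<times> topspace X"
  using assms partial_order_onD[of "topspace X" r] by (auto simp only: priestley_space_def)

text \<open>By antisymmetry, distinct points fail to be related in at least one direction; a clopen
  upset witnessing this and its complement are the two separating open sets. This is needed so that
  compact images under \<open>f\<close> are closed.\<close>

lemma priestley_space_Hausdorff:
  assumes X: "priestley_space X r"
  shows "Hausdorff_space X"
proof -
  have sep: "\<exists>U V. openin X U \<and> openin X V \<and> x \<in> U \<and> y \<in> V \<and> disjnt U V"
    if "x \<in> topspace X" "y \<in> topspace X" "(x, y) \<notin> r" for x y
  proof -
    have "\<exists>U. clopenin X U \<and> upset_of r (topspace X) U \<and> x \<in> U \<and> y \<notin> U"
      using X that by (simp add: priestley_space_def)
    then obtain U where U: "clopenin X U" "x \<in> U" "y \<notin> U"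
      by blast
    have "openin X U" "openin X (topspace X - U)"
      using U(1) by (auto simp: clopenin_def)
    moreover have "y \<in> topspace X - U" "disjnt U (topspace X - U)"
      using that U by (auto simp: disjnt_def)
    ultimately show ?thesis
      using U(2) by blast
  qed
  show ?thesis
    unfolding Hausdorff_space_def
  proof clarify
    fix x y
    assume xy: "x \<in> topspace X" "y \<in> topspace X" "x \<noteq> y"
    then have "(x, y) \<notin> r \<or> (y, x) \<notin> r"
      using priestley_spaceD(4)[OF X] by (auto simp: antisym_def)
    then show "\<exists>U V. openin X U \<and> openin X V \<and> x \<in> U \<and> y \<in> V \<and> disjnt U V"
    proof
      assume "(x, y) \<notin> r"
      with sep xy show ?thesis by blast
    next
      assume "(y, x) \<notin> r"
      with sep[of y x] xy show ?thesis by (metis disjnt_sym)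
    qed
  qed
qed

text \<open>If \<open>c\<close> is not below \<open>x\<close>, a clopen upset containing
  \<open>c\<close> but not \<open>x\<close> contains all of \<open>r\<close>
  {c}\<open>, so its complement is a neighbourhood of\<close>x\<open>that misses\<close>r
  \<open>{c}\<close>.\<close>

lemma priestley_space_closedin_principal_upset:
  assumes X: "priestley_space X r" and c: "c \<in> topspace X"
  shows "closedin X (r `` {c})"
  unfolding closedin_def
proof
  show "r `` {c} \<subseteq> topspace X"
    using priestley_spaceD(5)[OF X] by auto
  show "openin X (topspace X - r `` {c})"
  proof (subst openin_subopen, intro ballI)
    fix x assume x: "x \<in> topspace X - r `` {c}"
    then obtain U where U: "clopenin X U" "upset_of r (topspace X) U" "c \<in> U" "x \<notin> U"
      using X c unfolding priestley_space_def by auto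
    then have "topspace X - U \<subseteq> topspace X - r `` {c}"
      by (auto simp: upset_of_def)
    with U x show "\<exists>T. openin X T \<and> x \<in> T \<and> T \<subseteq> topspace X - r `` {c}"
      unfolding clopenin_def by blast
  qed
qed

lemma least_elem_CC:
  assumes "priestley_space X r" and "C \<in> CC X r"
  shows "least_elem r C \<in> C" and "\<And>y. y \<in> C \<Longrightarrow> (least_elem r C, y) \<in> r"
  using theI'[OF CC_least_ex1[OF assms]] unfolding least_elem_def by auto

lemma least_elem_eqI:
  assumes X: "priestley_space X r" and C: "C \<in> CC X r"
    and "x \<in> C" and "\<And>y. y \<in> C \<Longrightarrow> (x, y) \<in> r"
  shows "least_elem r C = x"
  using least_elem_CC[OF X C] assms(3,4) antisymD[OF priestley_spaceD(4)[OF X]] by blast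

lemma CC_mono:
  assumes "C \<in> CC X r" and "D \<subseteq> C" and "D \<noteq> {}" and "closedin X D"
  shows "D \<in> CC X r"
  using assms unfolding CC_def Chains_def by blast

text \<open>This makes the existence of least elements of closed chains available in
  \<open>Y\<close> itself, for closed nonempty subsets of a principal upset.\<close>

lemma principal_upset_in_CC:
  assumes "esakia_root_system Y r" and y: "y \<in> topspace Y"
  shows "r `` {y} \<in> CC Y r"
proof -
  have Y: "priestley_space Y r" and "r `` {y} \<in> Chains r"
    using assms by (auto simp: esakia_root_system_def)
  moreover have "(y, y) \<in> r"
    using y priestley_spaceD(2)[OF Y] by (simp add: refl_on_def)
  ultimately show ?thesis
    using priestley_space_closedin_principal_upset[OF Y y] by (auto simp: CC_def)
qed

section \<open>The map sending \<open>y\<close> to the \<open>f\<close>-image of its principal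
  upset, and its uniqueness\<close>

locale esakia_root_map =
  fixes X :: "'a topology" and rX :: "'a rel"
    and Y :: "'b topology" and rY :: "'b rel"
    and f :: "'b \<Rightarrow> 'a"
  assumes X: "priestley_space X rX"
    and Y: "esakia_root_system Y rY"
    and cont: "continuous_map Y X f"
    and mono: "monotone_on (topspace Y) (\<lambda>x y. (x, y) \<in> rY) (\<lambda>x y. (x, y) \<in> rX) f"
begin

lemma Y_priestley: "priestley_space Y rY"
  using Y by (simp add: esakia_root_system_def)

lemmas X_order = priestley_spaceD[OF X]
lemmas Y_order = priestley_spaceD[OF Y_priestley]

lemma f_mono: "(f x, f y) \<in> rX" if "(x, y) \<in> rY"
  using mono that Y_order(5) by (auto simp: monotone_on_def)

lemma Y_refl: "(y, y) \<in> rY" if "y \<in> topspace Y"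
  using that Y_order(2) by (simp add: refl_on_def)

lemma Y_linear: "(v, w) \<in> rY \<or> (w, v) \<in> rY" if "(y, v) \<in> rY" "(y, w) \<in> rY"
proof -
  have "rY `` {y} \<in> Chains rY"
    using Y that Y_order(5) by (auto simp: esakia_root_system_def)
  then show ?thesis
    using that by (auto simp: Chains_def)
qed

text \<open>The image is closed because it is compact in a Hausdorff space, and a chain because
  \<open>f\<close> preserves comparability.\<close>

lemma image_upset_in_CC:
  assumes y: "y \<in> topspace Y"
  shows "f ` (rY `` {y}) \<in> CC X rX"
proof -
  have "compactin Y (rY `` {y})"
    using Y_order(1) priestley_space_closedin_principal_upset[OF Y_priestley y]
    by (rule closedin_compact_space)
  then have "closedin X (f ` (rY `` {y}))"
    using compactin_imp_closedin[OF priestley_space_Hausdorff[OF X]] image_compactin cont by blast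
  moreover have "f ` (rY `` {y}) \<in> Chains rX"
    unfolding Chains_def using Y_linear f_mono by blast
  ultimately show ?thesis
    using Y_refl[OF y] by (auto simp: CC_def)
qed

lemma least_elem_image_upset:
  assumes y: "y \<in> topspace Y"
  shows "least_elem rX (f ` (rY `` {y})) = f y"
  using least_elem_eqI[OF X image_upset_in_CC[OF y]] Y_refl[OF y] f_mono by blast

text \<open>The Esakia condition on \<open>Y\<close> enters here: it makes preimages of the
  generators of the topology of \<open>CC X rX\<close> clopen.\<close>

lemma clopenin_downset_vimage:
  assumes "clopenin X V"
  shows "clopenin Y (rY\<inverse> `` {y \<in> topspace Y. f y \<in> V})"
proof -
  have "clopenin Y {y \<in> topspace Y. f y \<in> V}"
    using assms cont closedin_continuous_map_preimage openin_continuous_map_preimage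
    unfolding clopenin_def by blast
  then show ?thesis
    using Y by (simp add: esakia_root_system_def)
qed

lemma continuous_map_image_upset:
  "continuous_map Y (CC_topology X rX) (\<lambda>y. f ` (rY `` {y}))" (is "continuous_map _ _ ?g")
  unfolding CC_topology_def
proof (rule continuous_on_generated_topo)
  have f: "f y \<in> topspace X" if "y \<in> topspace Y" for y
    using cont that by (auto simp: continuous_map_def)
  fix U
  assume "U \<in> {CC_box X rX V |V. clopenin X V} \<union> {CC_diamond X rX V |V. clopenin X V}"
  then obtain V where V: "clopenin X V" and "U = CC_box X rX V \<or> U = CC_diamond X rX V"
    by blast
  then show "openin Y (?g -` U \<inter> topspace Y)"
  proof (elim disjE)
    assume U: "U = CC_box X rX V"
    \<comment> \<open>The image of the upset of \<open>y\<close> leaves \<open>V\<close> exactly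
      when \<open>y\<close> lies below a point that \<open>f\<close> sends outside
      \<open>V\<close>.\<close>
    let ?D = "rY\<inverse> `` {y \<in> topspace Y. f y \<in> topspace X - V}"
    have "clopenin X (topspace X - V)"
      using V by (auto simp: clopenin_def)
    then have "openin Y (topspace Y - ?D)"
      using clopenin_downset_vimage unfolding clopenin_def by blast
    moreover have "?g -` U \<inter> topspace Y = topspace Y - ?D"
      using image_upset_in_CC Y_order(5) f by (fastforce simp: U CC_box_def)
    ultimately show ?thesis by simp
  next
    assume U: "U = CC_diamond X rX V"
    have "?g -` U \<inter> topspace Y = rY\<inverse> `` {y \<in> topspace Y. f y \<in> V}"
      using image_upset_in_CC Y_order(5) by (fastforce simp: U CC_diamond_def)
    then show ?thesis
      using clopenin_downset_vimage[OF V] by (simp add: clopenin_def)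
  qed
next
  have "?g ` topspace Y \<subseteq> topspace (CC_topology X rX)"
    using image_upset_in_CC by auto
  then show "?g ` topspace Y \<subseteq>
      \<Union> ({CC_box X rX V |V. clopenin X V} \<union> {CC_diamond X rX V |V. clopenin X V})"
    by (simp only: CC_topology_def topology_generated_by_topspace)
qed

text \<open>The forth half of the p-morphism condition. For the upset property, take
  \<open>w\<close> above \<open>y\<close> with \<open>f w\<close> above some \<open>f z'\<close>,
  where \<open>z'\<close> is above \<open>z\<close>. If \<open>w\<close> is not above
  \<open>z\<close>, linearity puts it below \<open>z\<close>, so \<open>f w\<close> is also below
  \<open>f z'\<close> and the two values coincide.\<close>

lemma image_upset_antimono:
  assumes yz: "(y, z) \<in> rY"
  shows "(f ` (rY `` {y}), f ` (rY `` {z})) \<in> CC_order X rX"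
proof -
  have sub: "f ` (rY `` {z}) \<subseteq> f ` (rY `` {y})"
    using yz Y_order(3) by (auto dest: transD)
  have "f w \<in> f ` (rY `` {z})"
    if z': "(z, z') \<in> rY" and w: "(y, w) \<in> rY" and le: "(f z', f w) \<in> rX" for z' w
  proof (cases "(z, w) \<in> rY")
    case False
    then have "(w, z) \<in> rY"
      using Y_linear yz w by blast
    then have "(f w, f z') \<in> rX"
      using f_mono z' Y_order(3) by (blast dest: transD)
    then have "f w = f z'"
      using le X_order(4) by (auto dest: antisymD)
    then show ?thesis using z' by auto
  qed auto
  then have "upset_of rX (f ` (rY `` {y})) (f ` (rY `` {z}))"
    using sub unfolding upset_of_def by blast
  then show ?thesis
    using sub image_upset_in_CC yz Y_order(5) by (auto simp: CC_order_def)
qed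

text \<open>The back half of the p-morphism condition.\<close>

lemma CC_order_image_upsetE:
  assumes y: "y \<in> topspace Y" and C: "(f ` (rY `` {y}), C) \<in> CC_order X rX"
  obtains z where "(y, z) \<in> rY" and "C = f ` (rY `` {z})"
proof -
  have CC: "C \<in> CC X rX" and sub: "C \<subseteq> f ` (rY `` {y})" and up: "upset_of rX (f ` (rY `` {y})) C"
    using C by (auto simp: CC_order_def)
  \<comment> \<open>The least element \<open>z\<close> of this closed chain is the witness. Points
    above \<open>z\<close> map into \<open>C\<close> since \<open>f z\<close> is in \<open>C\<close>
    and \<open>C\<close> is an upset of the image; conversely, every element of \<open>C\<close> is
    \<open>f w\<close> for some \<open>w\<close> in \<open>D\<close>, hence for some
    \<open>w\<close> above \<open>z\<close>.\<close>
  define D where "D = rY `` {y} \<inter> {w \<in> topspace Y. f w \<in> C}"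
  have "closedin X C" "C \<noteq> {}"
    using CC by (auto simp: CC_def)
  then have "closedin Y D"
    unfolding D_def
    using priestley_space_closedin_principal_upset[OF Y_priestley y]
      closedin_continuous_map_preimage[OF cont] by blast
  moreover have D: "w \<in> D \<longleftrightarrow> (y, w) \<in> rY \<and> f w \<in> C" for w
    using Y_order(5) by (auto simp: D_def)
  have "D \<noteq> {}"
    using \<open>C \<noteq> {}\<close> sub D by blast
  ultimately have "D \<in> CC Y rY"
    using CC_mono[OF principal_upset_in_CC[OF Y y]] by (simp add: D_def)
  then obtain z where z: "z \<in> D" "\<And>w. w \<in> D \<Longrightarrow> (z, w) \<in> rY"
    using least_elem_CC[OF Y_priestley] by blast
  have "f w \<in> C" if "(z, w) \<in> rY" for w
  proof -
    have "(y, w) \<in> rY"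
      using z(1) that D Y_order(3) by (blast dest: transD)
    then show ?thesis
      using up z(1) D f_mono[OF that] unfolding upset_of_def by blast
  qed
  moreover have "C \<subseteq> f ` (rY `` {z})"
    using sub z(2) D by blast
  ultimately have "C = f ` (rY `` {z})"
    by blast
  with z(1) D show thesis
    using that by blast
qed

lemma p_morphism_image_upset:
  "p_morphism (topspace Y) rY (CC X rX) (CC_order X rX) (\<lambda>y. f ` (rY `` {y}))"
  unfolding p_morphism_def
proof (intro conjI ballI)
  show "(\<lambda>y. f ` (rY `` {y})) \<in> topspace Y \<rightarrow> CC X rX"
    using image_upset_in_CC by blast
next
  fix y assume y: "y \<in> topspace Y"
  show "(\<lambda>y. f ` (rY `` {y})) ` (rY `` {y}) = CC_order X rX `` {f ` (rY `` {y})}"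
    using image_upset_antimono CC_order_image_upsetE[OF y] by blast
qed

text \<open>The forth condition gives one inclusion: for \<open>z\<close> above \<open>y\<close>,
  the least element \<open>f z\<close> of \<open>g z\<close> lies in \<open>g y\<close>. The back
  condition gives the other.\<close>

lemma p_morphism_eq_image_upset:
  assumes g: "p_morphism (topspace Y) rY (CC X rX) (CC_order X rX) g"
    and least: "\<And>y. y \<in> topspace Y \<Longrightarrow> least_elem rX (g y) = f y"
    and y: "y \<in> topspace Y"
  shows "g y = f ` (rY `` {y})"
proof
  have gCC: "g z \<in> CC X rX" if "z \<in> topspace Y" for z
    using g that by (auto simp: p_morphism_def)
  have g_up: "g ` (rY `` {y}) = CC_order X rX `` {g y}"
    using g y by (simp add: p_morphism_def)
  show "f ` (rY `` {y}) \<subseteq> g y"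
  proof clarify
    fix z assume z: "(y, z) \<in> rY"
    then have "z \<in> topspace Y" "g z \<subseteq> g y"
      using g_up Y_order(5) by (auto simp: CC_order_def)
    then show "f z \<in> g y"
      using least_elem_CC(1)[OF X gCC] least by fastforce
  qed
  show "g y \<subseteq> f ` (rY `` {y})"
  proof
    fix c assume c: "c \<in> g y"
    have cl: "closedin X (g y)"
      using gCC[OF y] by (simp add: CC_def)
    then have cX: "c \<in> topspace X"
      using c closedin_subset by blast
    \<comment> \<open>Cutting \<open>g y\<close> off below \<open>c\<close> yields a member of
      \<open>CC X rX\<close> above \<open>g y\<close> whose least element is \<open>c\<close>; the
      back condition then makes it a value \<open>g z\<close>, whence
      \<open>c = f z\<close>.\<close>
    define C where "C = g y \<inter> rX `` {c}"
    have cC: "c \<in> C"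
      using c cX X_order(2) by (auto simp: C_def refl_on_def)
    have "closedin X C"
      unfolding C_def using cl priestley_space_closedin_principal_upset[OF X cX] by blast
    moreover have "C \<subseteq> g y" "C \<noteq> {}"
      using cC by (auto simp: C_def)
    ultimately have C: "C \<in> CC X rX"
      using CC_mono[OF gCC[OF y]] by blast
    have "upset_of rX (g y) C"
      using X_order(3) by (auto simp: upset_of_def C_def dest: transD)
    then have "(g y, C) \<in> CC_order X rX"
      using C gCC[OF y] by (auto simp: CC_order_def C_def)
    then obtain z where z: "(y, z) \<in> rY" "C = g z"
      using g_up by blast
    have "c = least_elem rX C"
      using least_elem_eqI[OF X C cC] by (simp add: C_def)
    also have "\<dots> = f z"
      using least z Y_order(5) by auto
    finally show "c \<in> f ` (rY `` {y})"
      using z by blast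
  qed
qed

end

theorem theorem3p16:
  fixes X :: "'a topology" and rX :: "'a rel"
    and Y :: "'b topology" and rY :: "'b rel"
    and f :: "'b \<Rightarrow> 'a"
  assumes "priestley_space X rX"
    and "esakia_root_system Y rY"
    and "continuous_map Y X f"
    and "monotone_on (topspace Y) (\<lambda>x y. (x, y) \<in> rY) (\<lambda>x y. (x, y) \<in> rX) f"
  shows "\<exists>!g. g \<in> extensional (topspace Y) \<and>
           continuous_map Y (CC_topology X rX) g \<and>
           p_morphism (topspace Y) rY (CC X rX) (CC_order X rX) g \<and>
           (\<forall>y\<in>topspace Y. least_elem rX (g y) = f y)"
proof -
  interpret esakia_root_map X rX Y rY f
    using assms by unfold_locales
  \<comment> \<open>Functions are total in HOL, so the map is set to \<open>undefined\<close> off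
    \<open>topspace Y\<close>; \<open>extensional\<close> makes uniqueness a genuine equality of
    functions.\<close>
  define g where "g = restrict (\<lambda>y. f ` (rY `` {y})) (topspace Y)"
  have g: "g y = f ` (rY `` {y})" if "y \<in> topspace Y" for y
    using that by (simp add: g_def)
  show ?thesis
  proof (rule ex1I[of _ g], intro conjI ballI)
    show "g \<in> extensional (topspace Y)"
      by (simp add: g_def)
    show "continuous_map Y (CC_topology X rX) g"
      using continuous_map_image_upset by (rule continuous_map_eq) (simp add: g)
    \<comment> \<open>Principal upsets stay inside \<open>topspace Y\<close>, where the restriction
      changes nothing, so the p-morphism condition carries over.\<close>
    have "g ` (rY `` {y}) = (\<lambda>y. f ` (rY `` {y})) ` (rY `` {y})" for y
      using g Y_order(5) by (intro image_cong) auto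
    then show "p_morphism (topspace Y) rY (CC X rX) (CC_order X rX) g"
      using p_morphism_image_upset g by (auto simp: p_morphism_def Pi_iff)
    show "least_elem rX (g y) = f y" if "y \<in> topspace Y" for y
      using that by (simp add: g least_elem_image_upset)
  next
    fix h
    assume "h \<in> extensional (topspace Y) \<and>
      continuous_map Y (CC_topology X rX) h \<and>
      p_morphism (topspace Y) rY (CC X rX) (CC_order X rX) h \<and>
      (\<forall>y\<in>topspace Y. least_elem rX (h y) = f y)"
    then show "h = g"
      using p_morphism_eq_image_upset g
      by (intro extensionalityI[of h "topspace Y" g]) (auto simp: g_def)
  qed
qed

end
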